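(* For all $a,m\ge 2$, $1^a23\cdots m\equiv 12\cdots(m-1)m^a$ as subwords on $NC_n$; that is, for every $n\ge 0$ and every $k\ge 0$, the number of $\pi\in NC_n$ having exactly $k$ occurrences of the subword $1^a23\cdots m$ equals the number of $\pi\in NC_n$ having exactly $k$ occurrences of the subword $12\cdots(m-1)m^a$.
   Context: A set partition of $[n]=\{1,\dots,n\}$ with blocks $B_1,\dots,B_k$ ordered so that $\min B_1<\cdots<\min B_k$ is represented by its canonical sequential form $\pi=\pi_1\cdots\pi_n$, where $i\in B_{\pi_i}$ for each $i$. It is non-crossing if $\pi$ contains no (not necessarily consecutive) subsequence of the form $a\,b\,a\,b$ with $a<b$. $NC_n$ denotes the set of non-crossing partitions of $[n]$, identified with their canonical sequential forms. An occurrence of a word $\tau=\tau_1\cdots\tau_k$ as a subword in a sequence $\sigma_1\cdots\sigma_n$ is an index $i\in[n-k+1]$ such that the string of consecutive letters $\sigma_i\cdots\sigma_{i+k-1}$ is order-isomorphic to $\tau$ (same relative order, including equalities). Here $1^a23\cdots m$ denotes $a$ copies of $1$ followed by $2,3,\dots,m$, and $12\cdots(m-1)m^a$ denotes $1,2,\dots,m-1$ followed by $a$ copies of $m$. *)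

theory Defs
  imports Complex_Main "HOL-Library.Disjoint_Sets"
begin

text \<open>A set partition of \<open>{1..n}\<close> is a set of blocks \<open>P\<close> with \<^term>\<open>partition_on {1..n} P\<close>.\<close>

definition block_of :: "nat set set \<Rightarrow> nat \<Rightarrow> nat set" where
  "block_of P i = (THE B. B \<in> P \<and> i \<in> B)"

text \<open>The index \<open>j\<close> of the block \<open>C = B\<^sub>j\<close> when the blocks are listed by increasing minimum,
  starting from 1; see \<open>block_index_bij\<close> and \<open>block_index_less_iff\<close> below.\<close>

definition block_index :: "nat set set \<Rightarrow> nat set \<Rightarrow> nat" where
  "block_index P C = card {B \<in> P. Min B \<le> Min C}"

definition canonical_form :: "nat \<Rightarrow> nat set set \<Rightarrow> nat list" where
  "canonical_form n P = map (\<lambda>i. block_index P (block_of P i)) [1..<Suc n]"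

definition contains_abab :: "nat list \<Rightarrow> bool" where
  "contains_abab w \<longleftrightarrow> (\<exists>p q r s. p < q \<and> q < r \<and> r < s \<and> s < length w \<and>
     w ! p = w ! r \<and> w ! q = w ! s \<and> w ! p < w ! q)"

definition NC :: "nat \<Rightarrow> nat set set set" where
  "NC n = {P. partition_on {1..n} P \<and> \<not> contains_abab (canonical_form n P)}"

definition order_isomorphic :: "nat list \<Rightarrow> nat list \<Rightarrow> bool" where
  "order_isomorphic u v \<longleftrightarrow> length u = length v \<and>
     (\<forall>i < length u. \<forall>j < length u.
        (u ! i < u ! j \<longleftrightarrow> v ! i < v ! j) \<and> (u ! i = u ! j \<longleftrightarrow> v ! i = v ! j))"

text \<open>Positions are counted from 0 here, which does not affect the number of occurrences.\<close>

definition subword_occurrences :: "nat list \<Rightarrow> nat list \<Rightarrow> nat set" where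
  "subword_occurrences t w =
     {i. i + length t \<le> length w \<and> order_isomorphic (take (length t) (drop i w)) t}"

definition subword_count :: "nat list \<Rightarrow> nat list \<Rightarrow> nat" where
  "subword_count t w = card (subword_occurrences t w)"

definition subword_equiv_NC :: "nat list \<Rightarrow> nat list \<Rightarrow> bool" where
  "subword_equiv_NC t u \<longleftrightarrow> (\<forall>n k.
     card {P \<in> NC n. subword_count t (canonical_form n P) = k} =
     card {P \<in> NC n. subword_count u (canonical_form n P) = k})"

text \<open>The cardinalities above are those of finite sets.\<close>

lemma finite_NC: "finite (NC n)"
proof (rule finite_subset)
  show "NC n \<subseteq> Pow (Pow {1..n})"
    by (auto simp: NC_def partition_on_def)
qed simp

lemma finite_subword_occurrences: "finite (subword_occurrences t w)"
  by (rule finite_subset[of _ "{..length w}"]) (auto simp: subword_occurrences_def)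

lemma block_of_eq:
  assumes "partition_on A P" "B \<in> P" "i \<in> B"
  shows "block_of P i = B"
  unfolding block_of_def
proof (rule the_equality)
  fix C assume "C \<in> P \<and> i \<in> C"
  with assms show "C = B"
    by (auto simp: partition_on_def disjoint_def)
qed (use assms in auto)

context
  fixes n :: nat and P :: "nat set set"
  assumes P: "partition_on {1..n} P"
begin

lemma finite_blocks: "finite P"
  using P finite_elements[of "{1..n}" P] by simp

lemma inj_on_Min_blocks: "inj_on Min P"
proof (rule inj_onI)
  fix B C assume BC: "B \<in> P" "C \<in> P" "Min B = Min C"
  have "finite D \<and> D \<noteq> {}" if "D \<in> P" for D
  proof -
    have "D \<subseteq> {1..n}" using P that by (auto simp: partition_on_def)
    moreover have "D \<noteq> {}" using P that by (auto simp: partition_on_def)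
    ultimately show ?thesis using finite_subset by blast
  qed
  with BC have "Min B \<in> B" "Min B \<in> C" by (metis Min_in)+
  with BC P show "B = C" by (metis block_of_eq)
qed

lemma block_index_less_iff:
  assumes "B \<in> P" "C \<in> P"
  shows "block_index P B < block_index P C \<longleftrightarrow> Min B < Min C"
proof -
  have less: "block_index P D < block_index P E" if "E \<in> P" "Min D < Min E" for D E
  proof -
    have "E \<in> {B \<in> P. Min B \<le> Min E} - {B \<in> P. Min B \<le> Min D}"
      using that by auto
    moreover have "{B \<in> P. Min B \<le> Min D} \<subseteq> {B \<in> P. Min B \<le> Min E}"
      using that by auto
    ultimately have "{B \<in> P. Min B \<le> Min D} \<subset> {B \<in> P. Min B \<le> Min E}"
      by blast
    then show ?thesis
      unfolding block_index_def using finite_blocks by (intro psubset_card_mono) auto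
  qed
  have le: "block_index P E \<le> block_index P D" if "Min E \<le> Min D" for D E
    unfolding block_index_def
    by (rule card_mono) (use that finite_blocks in auto)
  show ?thesis
    using less[of C B] le[of C B] assms by (meson not_le)
qed

lemma block_index_bij: "bij_betw (block_index P) P {1..card P}"
proof -
  have inj: "inj_on (block_index P) P"
    by (rule inj_onI)
       (metis block_index_less_iff inj_on_Min_blocks inj_onD less_irrefl nat_neq_iff)
  have "block_index P B \<in> {1..card P}" if "B \<in> P" for B
  proof -
    have "0 < card {D \<in> P. Min D \<le> Min B}"
      using that finite_blocks by (auto simp: card_gt_0_iff)
    moreover have "card {D \<in> P. Min D \<le> Min B} \<le> card P"
      by (rule card_mono) (use finite_blocks in auto)
    ultimately show ?thesis by (simp add: block_index_def)
  qed
  then have "block_index P ` P \<subseteq> {1..card P}" by blast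
  moreover have "card (block_index P ` P) = card {1..card P}"
    using inj by (simp add: card_image)
  ultimately have "block_index P ` P = {1..card P}"
    by (intro card_subset_eq) auto
  with inj show ?thesis by (simp add: bij_betw_def)
qed

end

end

theory Submission
  imports Defs
begin

text \<open>Reading a non-crossing canonical word from left to right, keep the stack of letters that may
  still be used: a letter \<open>x\<close> followed by a smaller one is lost. Each step pushes the next new
  letter, repeats the top, or pops at least one letter, so the word is encoded by the number \<open>c\<close> of
  entries dropped from the stack after pushing a new letter: \<open>0\<close> is an ascent, \<open>1\<close> a level and
  \<open>c \<ge> 2\<close> a descent. Occurrences of the two patterns become occurrences of the factors
  \<open>1\<^sup>a\<^sup>-\<^sup>1 0\<^sup>m\<^sup>-\<^sup>1\<close> and \<open>0\<^sup>m\<^sup>-\<^sup>1 1\<^sup>a\<^sup>-\<^sup>1\<close> in the code. Reversing every maximal run of codes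
  in \<open>{0, 1}\<close> exchanges the two factors, and keeps the stack nonempty because the height does not
  decrease along such a run.\<close>

section \<open>Canonical forms\<close>

text \<open>Restricted growth functions, phrased through earlier occurrences of smaller letters
  rather than a running maximum; they turn out to be exactly the canonical forms.\<close>

definition restricted_growth :: "nat list \<Rightarrow> bool" where
  "restricted_growth w \<longleftrightarrow>
     (\<forall>i<length w. 1 \<le> w ! i \<and> (\<forall>v. 1 \<le> v \<and> v < w ! i \<longrightarrow> (\<exists>j<i. w ! j = v)))"

text \<open>At the first disagreement the smaller of the two letters occurs earlier in the word
  carrying the larger one, at a position where the words agree; the common kernel then rules the
  disagreement out.\<close>

lemma restricted_growth_eqI:
  assumes "restricted_growth u" "restricted_growth w" and len: "length u = length w"
    and ker: "\<And>i j. i < length w \<Longrightarrow> j < length w \<Longrightarrow> u ! i = u ! j \<longleftrightarrow> w ! i = w ! j"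
  shows "u = w"
proof (rule nth_equalityI[OF len])
  fix i assume "i < length u"
  then show "u ! i = w ! i"
  proof (induction i rule: less_induct)
    case (less i)
    have same: "u ! j = w ! j" if "j < i" for j
      using less that by simp
    have i: "i < length u" "i < length w" using less len by auto
    have u: "1 \<le> u ! i" "\<And>v. 1 \<le> v \<Longrightarrow> v < u ! i \<Longrightarrow> \<exists>j<i. u ! j = v"
      using assms(1) i by (auto simp: restricted_growth_def)
    have w: "1 \<le> w ! i" "\<And>v. 1 \<le> v \<Longrightarrow> v < w ! i \<Longrightarrow> \<exists>j<i. w ! j = v"
      using assms(2) i by (auto simp: restricted_growth_def)
    have ker': "u ! j = u ! i \<longleftrightarrow> w ! j = w ! i" if "j < i" for j
      using ker[of j i] that i by simp
    show ?case
    proof (rule linorder_cases[of "u ! i" "w ! i"])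
      assume "u ! i < w ! i"
      then obtain j where "j < i" "w ! j = u ! i" using w(2) u(1) by blast
      then show ?thesis using same ker' by metis
    next
      assume "w ! i < u ! i"
      then obtain j where "j < i" "u ! j = w ! i" using u(2) w(1) by blast
      then show ?thesis using same ker' by metis
    qed
  qed
qed

lemma length_canonical_form [simp]: "length (canonical_form n P) = n"
  by (simp add: canonical_form_def)

lemma nth_canonical_form:
  "i < n \<Longrightarrow> canonical_form n P ! i = block_index P (block_of P (Suc i))"
  by (simp add: canonical_form_def del: upt_Suc)

lemma block_of_mem:
  assumes "partition_on A P" "i \<in> A"
  shows "block_of P i \<in> P" "i \<in> block_of P i"
  using assms block_of_eq[OF assms(1)] by (auto simp: partition_on_def)

lemma canonical_form_eq_iff:
  assumes P: "partition_on {1..n} P" and "i < n" "j < n"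
  shows "canonical_form n P ! i = canonical_form n P ! j \<longleftrightarrow>
    block_of P (Suc i) = block_of P (Suc j)"
proof -
  have "inj_on (block_index P) P"
    using block_index_bij[OF P] by (simp add: bij_betw_def)
  then show ?thesis
    using block_of_mem(1)[OF P] assms(2,3) by (simp add: nth_canonical_form inj_on_eq_iff)
qed

lemma restricted_growth_canonical_form:
  assumes P: "partition_on {1..n} P"
  shows "restricted_growth (canonical_form n P)"
  unfolding restricted_growth_def
proof (intro allI impI conjI)
  fix i assume "i < length (canonical_form n P)"
  then have i: "i < n" by simp
  define C where "C = block_of P (Suc i)"
  have C: "C \<in> P" "Suc i \<in> C" using block_of_mem[OF P] i by (auto simp: C_def)
  have range: "block_index P ` P = {1..card P}"
    using block_index_bij[OF P] by (simp add: bij_betw_def)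
  show "1 \<le> canonical_form n P ! i"
    using range C i by (auto simp: nth_canonical_form C_def)
  fix v assume "1 \<le> v \<and> v < canonical_form n P ! i"
  then have v: "1 \<le> v" "v < block_index P C" using i by (auto simp: nth_canonical_form C_def)
  moreover have "block_index P C \<le> card P" using range C by auto
  ultimately have "v \<in> block_index P ` P" using range by auto
  then obtain B where B: "B \<in> P" "block_index P B = v" by auto
  have sub: "D \<subseteq> {1..n}" if "D \<in> P" for D
    using P that by (auto simp: partition_on_def)
  then have fin: "finite D" if "D \<in> P" for D
    using that finite_subset by blast
  \<comment> \<open>Smaller index means earlier minimum, so \<open>Min B\<close> precedes
    \<open>Suc i\<close>. As elements count from 1 and positions from 0, the witness will be
    \<open>Min B - 1\<close>.\<close>
  have "Min B < Min C" using block_index_less_iff[OF P B(1) C(1)] v B by simp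
  also have "\<dots> \<le> Suc i" using C fin by simp
  finally have "Min B < Suc i" .
  moreover have "B \<noteq> {}" using P B by (auto simp: partition_on_def)
  ultimately have m: "Min B < Suc i" "Min B \<in> B" using B fin by simp_all
  then have "1 \<le> Min B" using sub B by force
  then have "canonical_form n P ! (Min B - 1) = v"
    using m i B block_of_eq[OF P B(1) m(2)] by (simp add: nth_canonical_form)
  then show "\<exists>j<i. canonical_form n P ! j = v"
    using m \<open>1 \<le> Min B\<close> by (intro exI[of _ "Min B - 1"]) auto
qed

section \<open>Inverting the canonical form\<close>

definition partition_of_word :: "nat list \<Rightarrow> nat set set" where
  "partition_of_word w =
     (\<lambda>i. {j \<in> {1..length w}. w ! (j - 1) = w ! (i - 1)}) ` {1..length w}"

lemma partition_on_partition_of_word: "partition_on {1..length w} (partition_of_word w)"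
  by (fastforce simp: partition_on_def partition_of_word_def disjoint_def)

lemma block_of_partition_of_word:
  assumes "i < length w"
  shows "block_of (partition_of_word w) (Suc i) = {j \<in> {1..length w}. w ! (j - 1) = w ! i}"
  by (rule block_of_eq[OF partition_on_partition_of_word])
     (use assms in \<open>auto simp: partition_of_word_def intro!: image_eqI[of _ _ "Suc i"]\<close>)

text \<open>Both words have restricted growth and the same equality pattern, so
  \<open>restricted_growth_eqI\<close> identifies them.\<close>

lemma canonical_form_partition_of_word:
  assumes "restricted_growth w"
  shows "canonical_form (length w) (partition_of_word w) = w"
proof (rule restricted_growth_eqI)
  let ?P = "partition_of_word w"
  show "restricted_growth (canonical_form (length w) ?P)"
    by (rule restricted_growth_canonical_form[OF partition_on_partition_of_word])
  fix i j assume ij: "i < length w" "j < length w"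
  have "block_of ?P (Suc i) = block_of ?P (Suc j) \<longleftrightarrow> w ! i = w ! j"
  proof
    assume "block_of ?P (Suc i) = block_of ?P (Suc j)"
    moreover have "Suc i \<in> block_of ?P (Suc i)"
      using ij by (simp add: block_of_partition_of_word)
    ultimately show "w ! i = w ! j"
      using ij by (simp add: block_of_partition_of_word)
  qed (use ij in \<open>simp add: block_of_partition_of_word\<close>)
  then show "canonical_form (length w) ?P ! i = canonical_form (length w) ?P ! j \<longleftrightarrow> w ! i = w ! j"
    using canonical_form_eq_iff[OF partition_on_partition_of_word] ij by simp
qed (use assms in auto)

text \<open>Indices are injective on blocks, so equal forms mean that the same pairs of elements
  share a block.\<close>

lemma inj_on_canonical_form: "inj_on (canonical_form n) {P. partition_on {1..n} P}"
proof (rule inj_onI, clarify)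
  fix P Q assume P: "partition_on {1..n} P" and Q: "partition_on {1..n} Q"
    and eq: "canonical_form n P = canonical_form n Q"
  have sub: "R \<subseteq> S" if R: "partition_on {1..n} R" and S: "partition_on {1..n} S"
    and eq: "canonical_form n R = canonical_form n S" for R S
  proof
    fix B assume B: "B \<in> R"
    then have "B \<noteq> {}" using R by (auto simp: partition_on_def)
    then obtain i where i: "i \<in> B" by blast
    then have "i \<in> {1..n}" using R B by (auto simp: partition_on_def)
    have mem: "j \<in> block_of T i \<longleftrightarrow> block_of T j = block_of T i"
      if "partition_on {1..n} T" "j \<in> {1..n}" for T j
      using that \<open>i \<in> {1..n}\<close> block_of_mem[OF that(1)] block_of_eq[OF that(1)] by metis
    have same: "block_of R j = block_of R i \<longleftrightarrow> block_of S j = block_of S i" if "j \<in> {1..n}" for j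
    proof -
      have *: "j - 1 < n" "i - 1 < n" "Suc (j - 1) = j" "Suc (i - 1) = i"
        using that \<open>i \<in> {1..n}\<close> by auto
      show ?thesis
        using canonical_form_eq_iff[OF R *(1,2)] canonical_form_eq_iff[OF S *(1,2)] eq
        unfolding *(3,4) by simp
    qed
    have sub: "block_of T i \<subseteq> {1..n}" if "partition_on {1..n} T" for T
      using block_of_mem[OF that \<open>i \<in> {1..n}\<close>] that by (auto simp: partition_on_def)
    have "block_of R i = block_of S i"
    proof (rule set_eqI)
      fix j
      show "j \<in> block_of R i \<longleftrightarrow> j \<in> block_of S i"
        using mem[OF R, of j] mem[OF S, of j] same[of j] sub[OF R] sub[OF S]
        by (cases "j \<in> {1..n}") (simp, blast)
    qed
    then show "B \<in> S"
      using block_of_eq[OF R B i] block_of_mem[OF S \<open>i \<in> {1..n}\<close>] by simp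
  qed
  show "P = Q" using sub[OF P Q eq] sub[OF Q P eq[symmetric]] by blast
qed

definition nc_word :: "nat list \<Rightarrow> bool" where
  "nc_word w \<longleftrightarrow> restricted_growth w \<and> \<not> contains_abab w"

text \<open>Transfers the counting from partitions to words; \<open>Q\<close> will prescribe the
  number of occurrences of a pattern.\<close>

lemma card_NC_filter:
  "card {P \<in> NC n. Q (canonical_form n P)} = card {w. length w = n \<and> nc_word w \<and> Q w}"
proof (rule bij_betw_same_card)
  show "bij_betw (canonical_form n) {P \<in> NC n. Q (canonical_form n P)}
    {w. length w = n \<and> nc_word w \<and> Q w}"
    unfolding bij_betw_def
  proof
    show "inj_on (canonical_form n) {P \<in> NC n. Q (canonical_form n P)}"
      by (rule inj_on_subset[OF inj_on_canonical_form]) (auto simp: NC_def)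
    show "canonical_form n ` {P \<in> NC n. Q (canonical_form n P)} =
      {w. length w = n \<and> nc_word w \<and> Q w}" (is "?L = ?R")
    proof
      show "?L \<subseteq> ?R"
        using restricted_growth_canonical_form by (auto simp: NC_def nc_word_def)
      show "?R \<subseteq> ?L"
      proof clarify
        fix w assume "nc_word w" "Q w" "n = length w"
        then show "w \<in> canonical_form (length w) ` {P \<in> NC (length w). Q (canonical_form (length w) P)}"
          using canonical_form_partition_of_word[of w] partition_on_partition_of_word[of w]
          by (intro image_eqI[of _ _ "partition_of_word w"]) (auto simp: NC_def nc_word_def)
      qed
    qed
  qed
qed

section \<open>Encoding non-crossing words\<close>

text \<open>The letters that may recur without closing an \<open>abab\<close>: nothing smaller has
  come after them. They are the entries of the stack.\<close>

definition available :: "nat list \<Rightarrow> nat set" where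
  "available p = {x \<in> set p. \<forall>j k. j < k \<and> k < length p \<and> p ! j = x \<longrightarrow> x \<le> p ! k}"

section \<open>Extending a non-crossing word by one letter\<close>

lemma nc_word_appendD: "nc_word (p @ q) \<Longrightarrow> nc_word p"
proof -
  assume "nc_word (p @ q)"
  then have r: "restricted_growth (p @ q)" and c: "\<not> contains_abab (p @ q)"
    by (auto simp: nc_word_def)
  have "restricted_growth p"
    unfolding restricted_growth_def
  proof (intro allI impI conjI)
    fix i assume i: "i < length p"
    then have *: "1 \<le> (p @ q) ! i" "\<forall>v. 1 \<le> v \<and> v < (p @ q) ! i \<longrightarrow> (\<exists>j<i. (p @ q) ! j = v)"
      using r unfolding restricted_growth_def by auto
    then show "1 \<le> p ! i" using i by (simp add: nth_append)
    fix v assume "1 \<le> v \<and> v < p ! i"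
    then have "\<exists>j<i. (p @ q) ! j = v" using *(2) i by (simp add: nth_append)
    then show "\<exists>j<i. p ! j = v" using i by (auto simp: nth_append)
  qed
  moreover have "\<not> contains_abab p"
  proof
    assume "contains_abab p"
    then obtain i j k l where "i < j" "j < k" "k < l" "l < length p"
      "p ! i = p ! k" "p ! j = p ! l" "p ! i < p ! j"
      by (auto simp: contains_abab_def)
    then have "contains_abab (p @ q)"
      unfolding contains_abab_def
      by (intro exI[of _ i] exI[of _ j] exI[of _ k] exI[of _ l]) (auto simp: nth_append)
    with c show False by simp
  qed
  ultimately show ?thesis by (simp add: nc_word_def)
qed

text \<open>The letters form a down-closed set of positive integers. Hence
  \<open>card (set p)\<close> serves below as the current maximum.\<close>

lemma set_restricted_growth:
  assumes "restricted_growth p"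
  shows "set p = {1..card (set p)}"
proof -
  have sub: "set p \<subseteq> {1..}" and down: "\<And>x v. x \<in> set p \<Longrightarrow> 1 \<le> v \<Longrightarrow> v < x \<Longrightarrow> v \<in> set p"
    using assms unfolding restricted_growth_def
    by (auto simp: in_set_conv_nth) (metis order_less_trans)
  have "set p \<subseteq> {1..card (set p)}"
  proof
    fix x assume x: "x \<in> set p"
    then have "{1..x} \<subseteq> set p" using down sub by (auto simp: order_le_less)
    then have "card {1..x} \<le> card (set p)" by (intro card_mono) auto
    then show "x \<in> {1..card (set p)}" using x sub by auto
  qed
  then show ?thesis by (intro card_subset_eq) auto
qed

lemma restricted_growth_snoc:
  "restricted_growth (p @ [x]) \<longleftrightarrow> restricted_growth p \<and> 1 \<le> x \<and> x \<le> Suc (card (set p))"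
    (is "?L \<longleftrightarrow> ?R")
proof -
  have "?L \<longleftrightarrow> restricted_growth p \<and> 1 \<le> x \<and> (\<forall>v. 1 \<le> v \<and> v < x \<longrightarrow> v \<in> set p)"
    unfolding restricted_growth_def
    by (auto simp: less_Suc_eq nth_append in_set_conv_nth all_conj_distrib)
       (metis less_trans)+
  moreover have "(\<forall>v. 1 \<le> v \<and> v < x \<longrightarrow> v \<in> set p) \<longleftrightarrow> x \<le> Suc (card (set p))"
    if "restricted_growth p"
    by (subst set_restricted_growth[OF that]) (auto dest: spec[of _ "x - 1"])
  ultimately show ?thesis by blast
qed

text \<open>A new occurrence must end in \<open>x\<close> and so has a smaller letter after an
  earlier \<open>x\<close>. Conversely, such a smaller letter also occurs before that
  \<open>x\<close> by restricted growth, which completes the pattern.\<close>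

lemma contains_abab_snoc:
  assumes "restricted_growth p"
  shows "contains_abab (p @ [x]) \<longleftrightarrow> contains_abab p \<or> x \<in> set p - available p"
proof
  assume "contains_abab (p @ [x])"
  then obtain i j k l where ijkl: "i < j" "j < k" "k < l" "l < Suc (length p)"
    "(p @ [x]) ! i = (p @ [x]) ! k" "(p @ [x]) ! j = (p @ [x]) ! l" "(p @ [x]) ! i < (p @ [x]) ! j"
    by (auto simp: contains_abab_def)
  show "contains_abab p \<or> x \<in> set p - available p"
  proof (cases "l = length p")
    case True
    then have "p ! j = x" "p ! k < x" "k < length p" using ijkl by (auto simp: nth_append)
    then have "x \<in> set p" "x \<notin> available p"
      using ijkl(2) by (auto simp: available_def not_le)
    then show ?thesis by simp
  next
    case False
    then have "contains_abab p"
      unfolding contains_abab_def using ijkl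
      by (intro exI[of _ i] exI[of _ j] exI[of _ k] exI[of _ l]) (auto simp: nth_append)
    then show ?thesis ..
  qed
next
  assume "contains_abab p \<or> x \<in> set p - available p"
  then show "contains_abab (p @ [x])"
  proof
    assume "contains_abab p"
    then obtain i j k l where "i < j" "j < k" "k < l" "l < length p"
      "p ! i = p ! k" "p ! j = p ! l" "p ! i < p ! j"
      by (auto simp: contains_abab_def)
    then show ?thesis
      unfolding contains_abab_def
      by (intro exI[of _ i] exI[of _ j] exI[of _ k] exI[of _ l]) (auto simp: nth_append)
  next
    assume "x \<in> set p - available p"
    then obtain j k where jk: "j < k" "k < length p" "p ! j = x" "p ! k < x"
      by (auto simp: available_def not_le)
    moreover have "1 \<le> p ! k" using assms jk by (auto simp: restricted_growth_def)
    ultimately obtain i where "i < j" "p ! i = p ! k"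
      using assms unfolding restricted_growth_def by (metis less_trans)
    with jk show ?thesis
      unfolding contains_abab_def
      by (intro exI[of _ i] exI[of _ j] exI[of _ k] exI[of _ "length p"]) (auto simp: nth_append)
  qed
qed

lemma available_subset: "available p \<subseteq> set p"
  by (auto simp: available_def)

lemma nc_word_snoc:
  "nc_word (p @ [x]) \<longleftrightarrow> nc_word p \<and> x \<in> insert (Suc (card (set p))) (available p)"
proof (cases "restricted_growth p")
  case True
  then have "x \<in> set p \<longleftrightarrow> 1 \<le> x \<and> x \<le> card (set p)"
    by (subst set_restricted_growth) auto
  then show ?thesis
    using True available_subset[of p]
    by (auto simp: nc_word_def restricted_growth_snoc contains_abab_snoc)
qed (simp add: nc_word_def restricted_growth_snoc)

text \<open>Appending \<open>y\<close> spoils precisely the larger letters. That \<open>y\<close>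
  itself is available afterwards uses the hypothesis: an old \<open>y\<close> had to be available
  already.\<close>

lemma available_snoc:
  assumes "nc_word (p @ [y])"
  shows "available (p @ [y]) = {x \<in> insert y (available p). x \<le> y}"
proof -
  have y: "y \<notin> set p \<or> y \<in> available p"
    using assms by (auto simp: nc_word_def contains_abab_snoc restricted_growth_snoc)
  have *: "x \<in> available (p @ [y]) \<longleftrightarrow> x = y \<and> x \<notin> set p \<or> x \<in> available p \<and> x \<le> y" for x
  proof -
    have "(\<forall>j k. j < k \<and> k < length (p @ [y]) \<and> (p @ [y]) ! j = x \<longrightarrow> x \<le> (p @ [y]) ! k) \<longleftrightarrow>
      (\<forall>j k. j < k \<and> k < length p \<and> p ! j = x \<longrightarrow> x \<le> p ! k) \<and>
      (\<forall>j<length p. p ! j = x \<longrightarrow> x \<le> y)" (is "?L \<longleftrightarrow> ?R")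
    proof
      assume L: ?L
      have "x \<le> p ! k" if "j < k" "k < length p" "p ! j = x" for j k
        using L[rule_format, of j k] that by (simp add: nth_append)
      moreover have "x \<le> y" if "j < length p" "p ! j = x" for j
        using L[rule_format, of j "length p"] that by (simp add: nth_append)
      ultimately show ?R by blast
    qed (auto simp: nth_append less_Suc_eq)
    moreover have "(\<forall>j<length p. p ! j = x \<longrightarrow> x \<le> y) \<longleftrightarrow> (x \<in> set p \<longrightarrow> x \<le> y)"
      by (auto simp: in_set_conv_nth)
    ultimately show ?thesis
      by (auto simp: available_def in_set_conv_nth)
  qed
  show ?thesis using y available_subset[of p] by (auto simp: *)
qed

section \<open>Codes and their decoding by a stack\<close>

fun valid_code :: "nat \<Rightarrow> nat list \<Rightarrow> bool" where
  "valid_code h [] \<longleftrightarrow> True"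
| "valid_code h (c # cs) \<longleftrightarrow> c \<le> h \<and> valid_code (Suc h - c) cs"

text \<open>\<open>st\<close> is the stack, top first, and \<open>mx\<close> the largest letter
  written. On a stack of letters at most \<open>mx\<close>, a new letter that is pushed and dropped
  at once leaves \<open>mx\<close> unchanged. In \<open>valid_code\<close>, \<open>h\<close> is the
  height before a step; \<open>c \<le> h\<close> keeps at least one of the \<open>Suc h\<close>
  entries present after the push.\<close>

fun decode :: "nat list \<Rightarrow> nat \<Rightarrow> nat list \<Rightarrow> nat list" where
  "decode st mx [] = []"
| "decode st mx (c # cs) =
     (let st' = drop c (Suc mx # st) in hd st' # decode st' (max mx (hd st')) cs)"

lemma length_decode [simp]: "length (decode st mx cs) = length cs"
  by (induction cs arbitrary: st mx) (simp_all add: Let_def)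

text \<open>Links the two views of a step: dropping entries from the top of the stack amounts to
  discarding the letters larger than the one exposed.\<close>

lemma set_drop_sorted_desc:
  fixes l :: "nat list"
  assumes "sorted_wrt (>) l" "c < length l"
  shows "set (drop c l) = {y \<in> set l. y \<le> l ! c}"
  using assms
proof (induction l arbitrary: c)
  case (Cons x l)
  show ?case
  proof (cases c)
    case 0
    then show ?thesis using Cons.prems by (auto simp: order_le_less)
  next
    case (Suc c')
    then have "l ! c' < x" using Cons.prems nth_mem[of c' l] by auto
    then show ?thesis using Cons.IH[of c'] Cons.prems Suc by (auto simp: not_le[symmetric])
  qed
qed simp

text \<open>The invariant of decoding: the stack decreases strictly from its top and lies below the
  next new letter.\<close>

lemma sorted_desc_step:
  assumes "sorted_wrt (>) (Suc mx # st)" "c \<le> length st"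
  shows "sorted_wrt (>) (Suc (max mx (hd (drop c (Suc mx # st)))) # drop c (Suc mx # st))"
proof -
  let ?l = "Suc mx # st"
  have "sorted_wrt (>) (drop c ?l)" using assms(1) by (rule sorted_wrt_drop)
  moreover have "y \<le> hd (drop c ?l)" if "y \<in> set (drop c ?l)" for y
    using that set_drop_sorted_desc[OF assms(1), of c] assms(2) by (simp add: hd_drop_conv_nth)
  ultimately show ?thesis by (auto simp: less_Suc_eq_le le_max_iff_disj)
qed

text \<open>By \<open>nc_word_snoc\<close> the admissible next letters are the entries of
  \<open>Suc (card (set p)) # st\<close>; choosing entry \<open>c\<close> is the code
  \<open>c\<close>, and \<open>drop c\<close> yields the available letters of the longer prefix. The
  prefix is arbitrary so that the induction on \<open>w\<close> can move letters into
  \<open>p\<close>.\<close>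

lemma nc_word_append_iff:
  assumes "nc_word p" "set st = available p" "sorted_wrt (>) st"
  shows "nc_word (p @ w) \<longleftrightarrow>
    (\<exists>cs. valid_code (length st) cs \<and> w = decode st (card (set p)) cs)"
  using assms
proof (induction w arbitrary: p st)
  case Nil
  show ?case using Nil by (auto intro!: exI[of _ "[]"])
next
  case (Cons x w)
  let ?mx = "card (set p)"
  let ?l = "Suc ?mx # st"
  have setp: "set p = {1..?mx}"
    using Cons.prems set_restricted_growth by (simp add: nc_word_def)
  then have "set st \<subseteq> {1..?mx}" using available_subset[of p] Cons.prems by simp
  then have l: "sorted_wrt (>) ?l" using Cons.prems by (auto simp: less_Suc_eq_le)
  have step: "nc_word (p @ [?l ! c] @ w) \<longleftrightarrow>
     (\<exists>cs. valid_code (Suc (length st) - c) cs \<and>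
        w = decode (drop c ?l) (max ?mx (?l ! c)) cs)" if c: "c \<le> length st" for c
  proof -
    let ?x = "?l ! c"
    have x: "?x \<in> set ?l" using c by (intro nth_mem) auto
    then have nc: "nc_word (p @ [?x])" using Cons.prems by (simp add: nc_word_snoc)
    have "set (drop c ?l) = {y \<in> set ?l. y \<le> ?x}"
      by (rule set_drop_sorted_desc[OF l]) (use c in simp)
    also have "\<dots> = available (p @ [?x])"
      using x Cons.prems \<open>set st \<subseteq> {1..?mx}\<close> by (auto simp: available_snoc[OF nc])
    finally have "set (drop c ?l) = available (p @ [?x])" .
    moreover have "card (set (p @ [?x])) = max ?mx ?x"
    proof (cases "?x = Suc ?mx")
      case True
      then have "?x \<notin> set p" by (subst setp) simp
      then show ?thesis using True by simp
    next
      case False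
      then have "?x \<in> set st" using x by simp
      then have "?x \<in> set p" "?x \<le> ?mx" using \<open>set st \<subseteq> {1..?mx}\<close> setp by auto
      then show ?thesis by (simp add: insert_absorb del: nth_Cons)
    qed
    ultimately show ?thesis
      using Cons.IH[OF nc, of "drop c ?l"] sorted_wrt_drop[OF l, of c] by (simp del: nth_Cons)
  qed
  show ?case
  proof
    assume nc: "nc_word (p @ x # w)"
    then have "nc_word (p @ [x])" using nc_word_appendD[of "p @ [x]" w] by simp
    then have "x \<in> set ?l" using Cons.prems by (simp add: nc_word_snoc)
    then obtain c where c: "c \<le> length st" "x = ?l ! c"
      by (metis in_set_conv_nth length_Cons less_Suc_eq_le)
    with nc step[of c] obtain cs where "valid_code (Suc (length st) - c) cs"
      "w = decode (drop c ?l) (max ?mx x) cs" by auto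
    then show "\<exists>cs. valid_code (length st) cs \<and> x # w = decode st ?mx cs"
      using c by (intro exI[of _ "c # cs"]) (simp add: Let_def hd_drop_conv_nth)
  next
    assume "\<exists>cs. valid_code (length st) cs \<and> x # w = decode st ?mx cs"
    then obtain c cs where "valid_code (length st) (c # cs)" "x # w = decode st ?mx (c # cs)"
      by (metis decode.simps(1) list.distinct(1) list.exhaust)
    then show "nc_word (p @ x # w)"
      using step[of c] by (auto simp: Let_def hd_drop_conv_nth)
  qed
qed

text \<open>The entries of \<open>Suc mx # st\<close> are distinct, so the first letter written
  reveals its code, and the invariant passes to the remainder.\<close>

lemma decode_inject:
  assumes "sorted_wrt (>) (Suc mx # st)" "valid_code (length st) cs" "valid_code (length st) ds"
    "decode st mx cs = decode st mx ds"
  shows "cs = ds"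
  using assms
proof (induction cs arbitrary: ds st mx)
  case Nil
  then show ?case by (metis decode.simps(1) length_0_conv length_decode)
next
  case (Cons c cs)
  then obtain d ds' where ds: "ds = d # ds'"
    by (metis length_decode length_Suc_conv)
  let ?l = "Suc mx # st"
  have cd: "c \<le> length st" "d \<le> length st" using Cons.prems ds by auto
  have "distinct ?l"
    using Cons.prems(1) strict_sorted_iff[of "rev ?l"] unfolding sorted_wrt_rev by simp
  moreover have "?l ! c = ?l ! d"
    using Cons.prems(4) cd by (simp add: ds Let_def hd_drop_conv_nth del: nth_Cons)
  ultimately have "c = d" using cd by (simp add: nth_eq_iff_index_eq del: distinct.simps nth_Cons)
  moreover have "cs = ds'"
  proof (rule Cons.IH)
    show "sorted_wrt (>) (Suc (max mx (hd (drop c ?l))) # drop c ?l)"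
      by (rule sorted_desc_step) (use Cons.prems cd in auto)
  qed (use Cons.prems ds \<open>c = d\<close> in \<open>auto simp: Let_def\<close>)
  ultimately show ?case by (simp add: ds)
qed

section \<open>Subword occurrences as factors of the code\<close>

text \<open>Every code other than 0 and 1 stands for a descent, whatever its depth; the patterns in
  question have no descents, so this coarse comparison suffices.\<close>

definition has_steps :: "nat list \<Rightarrow> nat list \<Rightarrow> bool" where
  "has_steps w cs \<longleftrightarrow> length w = Suc (length cs) \<and>
     (\<forall>j<length cs. (w ! j < w ! Suc j \<longleftrightarrow> cs ! j = 0) \<and> (w ! j = w ! Suc j \<longleftrightarrow> cs ! j = 1))"

lemma has_steps_Cons:
  "has_steps (x # y # w) (c # cs) \<longleftrightarrow>
     (x < y \<longleftrightarrow> c = 0) \<and> (x = y \<longleftrightarrow> c = 1) \<and> has_steps (y # w) cs"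
  unfolding has_steps_def length_Cons All_less_Suc2 by (simp add: conj_ac)

text \<open>The previous letter is entry 1 and the next one entry \<open>c\<close> of the decreasing
  list \<open>Suc mx # st\<close>, so comparing the letters amounts to comparing \<open>c\<close>
  with 1.\<close>

lemma has_steps_decode:
  assumes "sorted_wrt (>) (Suc mx # st)" "st \<noteq> []" "valid_code (length st) cs"
  shows "has_steps (hd st # decode st mx cs) cs"
  using assms
proof (induction cs arbitrary: st mx)
  case Nil
  then show ?case by (simp add: has_steps_def)
next
  case (Cons c cs)
  let ?l = "Suc mx # st"
  let ?st' = "drop c ?l"
  have c: "c \<le> length st" "valid_code (length ?st') cs" using Cons.prems by auto
  have hd: "hd ?st' = ?l ! c" "hd st = ?l ! 1"
    using c Cons.prems by (auto simp: hd_drop_conv_nth hd_conv_nth)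
  have "has_steps (hd ?st' # decode ?st' (max mx (hd ?st')) cs) cs"
    by (rule Cons.IH[OF sorted_desc_step]) (use Cons.prems c in auto)
  moreover have less: "?l ! j < ?l ! i" if "i < j" "j \<le> length st" for i j
    using sorted_wrt_nth_less[OF Cons.prems(1), of i j] that by simp
  have len: "1 \<le> length st" using Cons.prems by (cases st) auto
  have "(hd st < hd ?st' \<longleftrightarrow> c = 0) \<and> (hd st = hd ?st' \<longleftrightarrow> c = 1)"
  proof (rule linorder_cases[of c 1])
    assume "c < 1"
    then show ?thesis using less[of c 1] len unfolding hd by auto
  next
    assume "1 < c"
    then show ?thesis using less[of 1 c] c unfolding hd by auto
  qed (simp add: hd)
  ultimately show ?case by (simp add: Let_def has_steps_Cons)
qed

lemma has_steps_mono:
  assumes "has_steps u p" "set p \<subseteq> {0, 1}" "i \<le> j" "j \<le> length p"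
  shows "u ! i \<le> u ! j \<and> (u ! i = u ! j \<longleftrightarrow> (\<forall>k. i \<le> k \<and> k < j \<longrightarrow> p ! k = 1))"
  using assms(3,4)
proof (induction j rule: dec_induct)
  case (step j)
  have "p ! j \<in> set p" using step.prems by simp
  then have "p ! j \<in> {0, 1}" using assms(2) by blast
  then have "u ! j < u ! Suc j \<and> p ! j = 0 \<or> u ! j = u ! Suc j \<and> p ! j = 1"
    using assms(1) step.prems by (auto simp: has_steps_def)
  then show ?case using step by (auto simp: less_Suc_eq)
qed simp

text \<open>Without descents, the comparison of any two positions is determined by the steps between
  them (\<open>has_steps_mono\<close>), so neighbours decide order isomorphism.\<close>

lemma order_isomorphic_iff_has_steps:
  assumes t: "has_steps t p" and p: "set p \<subseteq> {0, 1}"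
  shows "order_isomorphic u t \<longleftrightarrow> has_steps u p"
proof
  assume iso: "order_isomorphic u t"
  then show "has_steps u p"
    using t by (simp add: order_isomorphic_def has_steps_def)
next
  assume u: "has_steps u p"
  have len: "length u = Suc (length p)" "length t = Suc (length p)"
    using t u by (auto simp: has_steps_def)
  have *: "(u ! i < u ! j \<longleftrightarrow> t ! i < t ! j) \<and> (u ! j < u ! i \<longleftrightarrow> t ! j < t ! i) \<and>
    (u ! i = u ! j \<longleftrightarrow> t ! i = t ! j)"
    if "i \<le> j" "j \<le> length p" for i j
  proof -
    have "t ! i \<le> t ! j" "u ! i \<le> u ! j" "u ! i = u ! j \<longleftrightarrow> t ! i = t ! j"
      using has_steps_mono[OF t p that] has_steps_mono[OF u p that] by simp_all
    then show ?thesis by linarith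
  qed
  have "(u ! i < u ! j \<longleftrightarrow> t ! i < t ! j) \<and> (u ! i = u ! j \<longleftrightarrow> t ! i = t ! j)"
    if "i \<le> length p" "j \<le> length p" for i j
  proof (cases "i \<le> j")
    case True
    then show ?thesis using *[of i j] that by blast
  next
    case False
    then show ?thesis using *[of j i] that by (simp add: eq_commute)
  qed
  then show "order_isomorphic u t"
    using len by (simp add: order_isomorphic_def less_Suc_eq_le)
qed

text \<open>Splittings \<open>u @ p @ v\<close> are counted in place of positions, which makes
  reversal and cutting at a letter plain list manipulations.\<close>

definition factor_count :: "'a list \<Rightarrow> 'a list \<Rightarrow> nat" where
  "factor_count p cs = card {(u, v). u @ p @ v = cs}"

lemma subword_count_eq_factor_count:
  assumes t: "has_steps t p" and p: "set p \<subseteq> {0, 1}" and w: "has_steps w cs"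
  shows "subword_count t w = factor_count p cs"
proof -
  have len: "length t = Suc (length p)" "length w = Suc (length cs)"
    using t w by (auto simp: has_steps_def)
  have "order_isomorphic (take (length t) (drop i w)) t \<longleftrightarrow> take (length p) (drop i cs) = p"
    if i: "i + length p \<le> length cs" for i
  proof -
    have "order_isomorphic (take (length t) (drop i w)) t \<longleftrightarrow>
        (\<forall>j<length p. (w ! (i + j) < w ! Suc (i + j) \<longleftrightarrow> p ! j = 0) \<and>
          (w ! (i + j) = w ! Suc (i + j) \<longleftrightarrow> p ! j = 1))"
      using len i by (simp add: order_isomorphic_iff_has_steps[OF t p] has_steps_def)
    also have "\<dots> \<longleftrightarrow>
        (\<forall>j<length p. (cs ! (i + j) = 0 \<longleftrightarrow> p ! j = 0) \<and> (cs ! (i + j) = 1 \<longleftrightarrow> p ! j = 1))"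
      using w i by (simp add: has_steps_def)
    \<comment> \<open>As \<open>p ! j\<close> is 0 or 1, agreeing on the two tests means being
      equal; a descent code fails both tests.\<close>
    also have "\<dots> \<longleftrightarrow> (\<forall>j<length p. cs ! (i + j) = p ! j)"
      using p nth_mem by (metis (no_types, lifting) empty_iff insertE subsetD)
    also have "\<dots> \<longleftrightarrow> take (length p) (drop i cs) = p"
      using i by (auto simp: list_eq_iff_nth_eq)
    finally show ?thesis .
  qed
  then have occ: "subword_occurrences t w =
      {i. i + length p \<le> length cs \<and> take (length p) (drop i cs) = p}" (is "_ = ?I")
    using len by (auto simp: subword_occurrences_def)
  \<comment> \<open>A splitting is determined by the length of its first part, which is the position
    of the occurrence.\<close>
  have "bij_betw (\<lambda>(u, v). length u) {(u, v). u @ p @ v = cs} ?I"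
    unfolding bij_betw_def
  proof
    show "inj_on (\<lambda>(u, v). length u) {(u, v). u @ p @ v = cs}"
      by (auto simp: inj_on_def)
    have "i \<in> (\<lambda>(u, v). length u) ` {(u, v). u @ p @ v = cs}" if "i \<in> ?I" for i
    proof (rule image_eqI)
      show "i = (\<lambda>(u, v). length u) (take i cs, drop (length p) (drop i cs))"
        using that by simp
      show "(take i cs, drop (length p) (drop i cs)) \<in> {(u, v). u @ p @ v = cs}"
        using that by (metis (mono_tags, lifting) append_take_drop_id case_prodI mem_Collect_eq)
    qed
    then show "(\<lambda>(u, v). length u) ` {(u, v). u @ p @ v = cs} = ?I"
      by auto
  qed
  then show ?thesis
    unfolding subword_count_def factor_count_def occ by (simp add: bij_betw_same_card)
qed

section \<open>Reversing runs\<close>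

lemma factor_count_rev: "factor_count (rev p) (rev cs) = factor_count p cs"
proof -
  have "bij_betw (\<lambda>(u, v). (rev v, rev u)) {(u, v). u @ p @ v = cs}
    {(u, v). u @ rev p @ v = rev cs}"
  proof (rule bij_betwI[where g = "\<lambda>(u, v). (rev v, rev u)"])
    show "(\<lambda>(u, v). (rev v, rev u)) \<in> {(u, v). u @ rev p @ v = rev cs} \<rightarrow> {(u, v). u @ p @ v = cs}"
      by (clarsimp, drule arg_cong[of _ _ rev]) simp
    show "(\<lambda>(u, v). (rev v, rev u)) \<in> {(u, v). u @ p @ v = cs} \<rightarrow> {(u, v). u @ rev p @ v = rev cs}"
      by auto
  qed (simp_all add: split_beta)
  then show ?thesis
    unfolding factor_count_def by (simp add: bij_betw_same_card)
qed

lemma finite_factorizations: "finite {(u, v). u @ p @ v = cs}"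
proof (rule finite_subset)
  show "{(u, v). u @ p @ v = cs} \<subseteq> (\<lambda>(i, j). (take i cs, drop j cs)) ` ({..length cs} \<times> {..length cs})"
  proof clarify
    fix u v assume "cs = u @ p @ v"
    then show "(u, v) \<in> (\<lambda>(i, j). (take i (u @ p @ v), drop j (u @ p @ v))) `
        ({..length (u @ p @ v)} \<times> {..length (u @ p @ v)})"
      by (intro image_eqI[of _ _ "(length u, length (u @ p))"]) simp_all
  qed
qed simp

text \<open>A factor that avoids \<open>d\<close> cannot straddle the displayed \<open>d\<close>, so
  it lies wholly to its left or to its right.\<close>

lemma factor_count_append_Cons:
  assumes "d \<notin> set p" "p \<noteq> []"
  shows "factor_count p (xs @ d # ys) = factor_count p xs + factor_count p ys"
proof -
  let ?F = "\<lambda>cs. {(u, v). u @ p @ v = cs}"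
  let ?l = "\<lambda>(u, v). (u, v @ d # ys)" and ?r = "\<lambda>(u, v). (xs @ d # u, v)"
  have split: "(\<exists>v'. v = v' @ d # ys \<and> u @ p @ v' = xs) \<or> (\<exists>u'. u = xs @ d # u' \<and> u' @ p @ v = ys)"
    if eq: "u @ p @ v = xs @ d # ys" for u v
  proof -
    \<comment> \<open>Compare the end of the factor \<open>p\<close> with the end of
      \<open>xs\<close>.\<close>
    from eq consider us where "u @ p = xs @ us" "us @ v = d # ys"
      | us where "u @ p @ us = xs" "v = us @ d # ys"
      using append_eq_append_conv2[of "u @ p" v xs "d # ys"] by auto
    then show ?thesis
    proof cases
      case 1
      then consider "us = []" | us' where "us = d # us'" "ys = us' @ v"
        by (cases us) auto
      then show ?thesis
      proof cases
        case 2
        \<comment> \<open>Here the displayed \<open>d\<close> falls inside \<open>u @ p\<close>;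
          since \<open>p\<close> avoids it, it lies in \<open>u\<close>.\<close>
        then obtain ws where "u = xs @ ws \<and> ws @ p = d # us' \<or> p = ws @ d # us'"
          using 1 append_eq_append_conv2[of u p xs us] by auto
        then have "u = xs @ ws" "ws @ p = d # us'" using assms by auto
        then show ?thesis using assms 2 by (cases ws) auto
      qed (use 1 in auto)
    qed auto
  qed
  have "?F (xs @ d # ys) = ?l ` ?F xs \<union> ?r ` ?F ys"
  proof (intro set_eqI iffI)
    fix z assume "z \<in> ?F (xs @ d # ys)"
    then obtain u v where z: "z = (u, v)" and "u @ p @ v = xs @ d # ys" by auto
    from split[OF this(2)] show "z \<in> ?l ` ?F xs \<union> ?r ` ?F ys"
      by (auto simp: z image_iff)
  qed auto
  moreover have "?l ` ?F xs \<inter> ?r ` ?F ys = {}"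
    by auto
  ultimately have "card (?F (xs @ d # ys)) = card (?l ` ?F xs) + card (?r ` ?F ys)"
    by (simp add: card_Un_disjoint finite_factorizations)
  moreover have "card (?l ` ?F xs) = card (?F xs)" "card (?r ` ?F ys) = card (?F ys)"
    by (auto intro!: card_image simp: inj_on_def)
  ultimately show ?thesis by (simp add: factor_count_def)
qed

text \<open>\<open>acc\<close> is the current run of codes 0 and 1, stored reversed; it is released
  at the next larger code or at the end.\<close>

fun reverse_runs_aux :: "nat list \<Rightarrow> nat list \<Rightarrow> nat list" where
  "reverse_runs_aux acc [] = acc"
| "reverse_runs_aux acc (c # cs) =
     (if c \<le> 1 then reverse_runs_aux (c # acc) cs else acc @ c # reverse_runs_aux [] cs)"

definition reverse_runs :: "nat list \<Rightarrow> nat list" where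
  "reverse_runs = reverse_runs_aux []"

lemma reverse_runs_run:
  assumes "set xs \<subseteq> {0, 1}"
  shows "reverse_runs xs = rev xs"
proof -
  have "reverse_runs_aux acc xs = rev xs @ acc" for acc
    using assms by (induction xs arbitrary: acc) auto
  then show ?thesis by (simp add: reverse_runs_def)
qed

lemma reverse_runs_append_Cons:
  assumes "set xs \<subseteq> {0, 1}" "d > 1"
  shows "reverse_runs (xs @ d # ys) = rev xs @ d # reverse_runs ys"
proof -
  have "reverse_runs_aux acc (xs @ d # ys) = rev xs @ acc @ d # reverse_runs ys" for acc
    using assms by (induction xs arbitrary: acc) (auto simp: reverse_runs_def)
  then show ?thesis by (simp add: reverse_runs_def)
qed

text \<open>Splitting at the first code above 1 leaves a run before it and a shorter code after it.
  The facts about \<open>reverse_runs\<close> on arbitrary codes are proved along this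
  decomposition.\<close>

lemma runs_induct [case_names run descent]:
  assumes run: "\<And>xs. set xs \<subseteq> {0, 1} \<Longrightarrow> P xs"
    and descent: "\<And>xs d ys. set xs \<subseteq> {0, 1} \<Longrightarrow> d > (1::nat) \<Longrightarrow> P ys \<Longrightarrow> P (xs @ d # ys)"
  shows "P cs"
proof (induction "length cs" arbitrary: cs rule: less_induct)
  case less
  show ?case
  proof (cases "\<exists>d\<in>set cs. d > 1")
    case True
    then obtain xs d ys where "cs = xs @ d # ys" "d > 1" "\<forall>x\<in>set xs. \<not> x > 1"
      using split_list_first_prop[of cs "\<lambda>d. d > 1"] by auto
    moreover have "set xs \<subseteq> {0, 1}" using calculation(3) by (force simp: not_less)
    ultimately show ?thesis using less descent by simp
  next
    case False
    then have "set cs \<subseteq> {0, 1}" by (force simp: not_less)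
    then show ?thesis by (rule run)
  qed
qed

lemma length_reverse_runs [simp]: "length (reverse_runs cs) = length cs"
  by (induction cs rule: runs_induct) (simp_all add: reverse_runs_run reverse_runs_append_Cons)

lemma reverse_runs_reverse_runs [simp]: "reverse_runs (reverse_runs cs) = cs"
  by (induction cs rule: runs_induct) (simp_all add: reverse_runs_run reverse_runs_append_Cons)

text \<open>At positive height the codes 0 and 1 are always admissible; 0 raises the height by one,
  1 keeps it. The height after a run thus depends only on its number of zeros, which reversal
  preserves.\<close>

lemma valid_code_run_append:
  assumes "set xs \<subseteq> {0, 1}" "h \<ge> 1"
  shows "valid_code h (xs @ ys) \<longleftrightarrow> valid_code (h + count_list xs 0) ys"
  using assms by (induction xs arbitrary: h) auto

lemma valid_code_reverse_runs:
  assumes "h \<ge> 1"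
  shows "valid_code h (reverse_runs cs) \<longleftrightarrow> valid_code h cs"
  using assms
proof (induction cs arbitrary: h rule: runs_induct)
  case (run xs)
  then show ?case
    using valid_code_run_append[of xs h "[]"] valid_code_run_append[of "rev xs" h "[]"]
    by (simp add: reverse_runs_run)
next
  case (descent xs d ys)
  \<comment> \<open>A valid descent leaves height at least 1, so the induction hypothesis applies
    after it.\<close>
  then show ?case
    by (auto simp: reverse_runs_append_Cons valid_code_run_append)
qed

text \<open>Codes above 1 do not occur in \<open>p\<close>, so the count is a sum over the runs, and
  each run is reversed on its own.\<close>

lemma factor_count_reverse_runs:
  assumes "set p \<subseteq> {0, 1}" "p \<noteq> []"
  shows "factor_count (rev p) (reverse_runs cs) = factor_count p cs"
proof (induction cs rule: runs_induct)
  case (run xs)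
  then show ?case by (simp add: reverse_runs_run factor_count_rev)
next
  case (descent xs d ys)
  then have "d \<notin> set p" using assms by auto
  then show ?case
    using descent assms
    by (simp add: reverse_runs_append_Cons factor_count_append_Cons factor_count_rev)
qed

section \<open>Equidistribution\<close>

lemma nc_word_singleton: "nc_word [1]"
  by (auto simp: nc_word_def restricted_growth_def contains_abab_def)

text \<open>A nonempty non-crossing word must start with 1, so decoding begins after the prefix
  \<open>[1]\<close>, with stack \<open>[1]\<close> and maximum 1.\<close>

lemma nc_word_length_Suc_iff:
  "nc_word w \<and> length w = Suc n \<longleftrightarrow>
     (\<exists>cs. valid_code 1 cs \<and> length cs = n \<and> w = 1 # decode [1] 1 cs)"
proof -
  have av: "available [1] = {1}" by (auto simp: available_def)
  have iff: "nc_word (1 # v) \<longleftrightarrow> (\<exists>cs. valid_code 1 cs \<and> v = decode [1] 1 cs)" for v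
    using nc_word_append_iff[OF nc_word_singleton, of "[1]" v] av by simp
  have hd: "x = 1" if "nc_word (x # v)" for x v
  proof -
    have "nc_word ([] @ [x])" using that nc_word_appendD[of "[x]" v] by simp
    then show ?thesis unfolding nc_word_snoc by (simp add: available_def)
  qed
  show ?thesis
  proof
    assume *: "nc_word w \<and> length w = Suc n"
    then obtain x v where w: "w = x # v" by (cases w) auto
    with * hd have "x = 1" by blast
    with * w iff[of v] show "\<exists>cs. valid_code 1 cs \<and> length cs = n \<and> w = 1 # decode [1] 1 cs"
      by auto
  qed (use iff in auto)
qed

lemma card_nc_words_subword_count:
  assumes t: "has_steps t p" and p: "set p \<subseteq> {0, 1}"
  shows "card {w. length w = Suc n \<and> nc_word w \<and> subword_count t w = k} =
    card {cs. length cs = n \<and> valid_code 1 cs \<and> factor_count p cs = k}"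
proof -
  \<comment> \<open>The initial 1 is the top of the starting stack, so the whole word has the steps
    \<open>cs\<close>.\<close>
  have count: "subword_count t (1 # decode [1] 1 cs) = factor_count p cs" if "valid_code 1 cs" for cs
    using subword_count_eq_factor_count[OF t p] has_steps_decode[of 1 "[1]" cs] that by simp
  have "bij_betw (\<lambda>cs. 1 # decode [1] 1 cs)
    {cs. length cs = n \<and> valid_code 1 cs \<and> factor_count p cs = k}
    {w. length w = Suc n \<and> nc_word w \<and> subword_count t w = k}"
    unfolding bij_betw_def
  proof
    show "inj_on (\<lambda>cs. 1 # decode [1] 1 cs)
        {cs. length cs = n \<and> valid_code 1 cs \<and> factor_count p cs = k}"
      using decode_inject[of 1 "[1]"] by (auto simp: inj_on_def)
    have "{w. length w = Suc n \<and> nc_word w \<and> subword_count t w = k} =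
      {w. (nc_word w \<and> length w = Suc n) \<and> subword_count t w = k}" by auto
    then show "(\<lambda>cs. 1 # decode [1] 1 cs) `
        {cs. length cs = n \<and> valid_code 1 cs \<and> factor_count p cs = k} =
        {w. length w = Suc n \<and> nc_word w \<and> subword_count t w = k}"
      unfolding nc_word_length_Suc_iff using count by auto
  qed
  then show ?thesis by (simp add: bij_betw_same_card)
qed

text \<open>\<open>reverse_runs\<close> is an involution on the valid codes of each length that
  trades the counts of \<open>p\<close> and \<open>rev p\<close>.\<close>

lemma subword_equiv_NC_rev_steps:
  assumes t: "has_steps t p" and t': "has_steps t' (rev p)" and p: "set p \<subseteq> {0, 1}" "p \<noteq> []"
  shows "subword_equiv_NC t t'"
  unfolding subword_equiv_NC_def
proof (intro allI)
  fix n k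
  show "card {P \<in> NC n. subword_count t (canonical_form n P) = k} =
    card {P \<in> NC n. subword_count t' (canonical_form n P) = k}"
  proof (cases n)
    \<comment> \<open>Codes describe nonempty words only. In the empty word neither pattern occurs,
      since each has at least one letter.\<close>
    case 0
    have "subword_count t [] = 0" "subword_count t' [] = 0"
      using t t' by (auto simp: subword_count_def subword_occurrences_def has_steps_def)
    then show ?thesis by (simp add: 0 canonical_form_def)
  next
    case (Suc n')
    have "bij_betw reverse_runs {cs. length cs = n' \<and> valid_code 1 cs \<and> factor_count p cs = k}
      {cs. length cs = n' \<and> valid_code 1 cs \<and> factor_count (rev p) cs = k}"
      by (rule bij_betwI[where g = reverse_runs])
         (use p factor_count_reverse_runs[of p] factor_count_reverse_runs[of "rev p"]
          in \<open>auto simp: valid_code_reverse_runs\<close>)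
    then have "card {cs. length cs = n' \<and> valid_code 1 cs \<and> factor_count p cs = k} =
      card {cs. length cs = n' \<and> valid_code 1 cs \<and> factor_count (rev p) cs = k}"
      by (rule bij_betw_same_card)
    then show ?thesis
      using card_nc_words_subword_count[OF t p(1), of n' k]
        card_nc_words_subword_count[OF t', of n' k] p(1)
        card_NC_filter[of n "\<lambda>w. subword_count t w = k"]
        card_NC_filter[of n "\<lambda>w. subword_count t' w = k"]
      by (simp add: Suc)
  qed
qed

theorem theorem12:
  fixes a m :: nat
  assumes "a \<ge> 2" and "m \<ge> 2"
  shows "subword_equiv_NC (replicate a 1 @ [2..<Suc m]) ([1..<m] @ replicate a m)"
proof (rule subword_equiv_NC_rev_steps)
  \<comment> \<open>The \<open>a\<close> equal letters give \<open>a - 1\<close> levels and the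
    climb to \<open>m\<close> gives \<open>m - 1\<close> ascents; the second pattern has the same
    steps in reverse order.\<close>
  let ?p = "replicate (a - 1) 1 @ replicate (m - 1) (0::nat)"
  \<comment> \<open>Step \<open>j\<close> joins positions \<open>j\<close> and \<open>Suc j\<close>,
    so it is a level when both lie among the \<open>a\<close> copies, that is, for
    \<open>j < a - 1\<close>.\<close>
  have p: "?p ! j = (if j < a - 1 then 1 else 0)" if "j < a + m - 2" for j
    using that by (simp add: nth_append)
  have rev_p: "rev ?p ! j = (if j < m - 1 then 0 else 1)" if "j < a + m - 2" for j
    using that by (simp add: nth_append)
  \<comment> \<open>The letter 2 sits at position \<open>a\<close>, whence
    \<open>j - a + 2\<close>.\<close>
  have t: "(replicate a 1 @ [2..<Suc m]) ! j = (if j < a then 1 else j - a + 2)"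
    if "j < a + m - 1" for j
    using that by (simp add: nth_append del: upt_Suc)
  have t': "([1..<m] @ replicate a m) ! j = (if j < m - 1 then Suc j else m)"
    if "j < a + m - 1" for j
    using that assms by (simp add: nth_append)
  show "has_steps (replicate a 1 @ [2..<Suc m]) ?p"
    unfolding has_steps_def
  proof (intro conjI allI impI)
    fix j assume "j < length ?p"
    then have "j < a + m - 2" "j < a + m - 1" "Suc j < a + m - 1" using assms by auto
    note eqs = p[OF this(1)] t[OF this(2)] t[OF this(3)]
    show "(replicate a 1 @ [2..<Suc m]) ! j < (replicate a 1 @ [2..<Suc m]) ! Suc j \<longleftrightarrow> ?p ! j = 0"
      "(replicate a 1 @ [2..<Suc m]) ! j = (replicate a 1 @ [2..<Suc m]) ! Suc j \<longleftrightarrow> ?p ! j = 1"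
      unfolding eqs by auto
  qed (use assms in simp)
  show "has_steps ([1..<m] @ replicate a m) (rev ?p)"
    unfolding has_steps_def
  proof (intro conjI allI impI)
    fix j assume "j < length (rev ?p)"
    then have "j < a + m - 2" "j < a + m - 1" "Suc j < a + m - 1" using assms by auto
    note eqs = rev_p[OF this(1)] t'[OF this(2)] t'[OF this(3)]
    show "([1..<m] @ replicate a m) ! j < ([1..<m] @ replicate a m) ! Suc j \<longleftrightarrow> rev ?p ! j = 0"
      "([1..<m] @ replicate a m) ! j = ([1..<m] @ replicate a m) ! Suc j \<longleftrightarrow> rev ?p ! j = 1"
      unfolding eqs by auto
  qed (use assms in simp)
  show "set ?p \<subseteq> {0, 1}" by auto
  show "?p \<noteq> []" using assms by simp
qed

end
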